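(* Let $G=G_1\ast_A G_2$ be an amalgam of finite groups. There is an algorithm which, given $h_1,\ldots,h_n\in G$, decides whether or not the subgroup $H=\langle h_1,\ldots,h_n\rangle$ of $G$ is trivial.
   Context: $G=G_1\ast_A G_2$ is a free product with amalgamation, where $G_1=\langle X_1\mid R_1\rangle$ and $G_2=\langle X_2\mid R_2\rangle$ are finite groups given by finite presentations with $X_1^{\pm}\cap X_2^{\pm}=\emptyset$, $A$ is a group generated by $Y$ with monomorphisms $\phi_i:A\to G_i$ ($i=1,2$), and $G=\langle X_1\cup X_2\mid R_1,R_2,\ \phi_1(a)=\phi_2(a)\ (a\in Y)\rangle$. The amalgam (the finite groups $G_1,G_2,A$, their presentations, the monomorphisms) is fixed and known to the algorithm. Elements of $G$ are input as words in the letters $X^{\pm}$, where $X=X_1\cup X_2$. *)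

theory Defs
  imports "HOL-Algebra.Generated_Groups" "HOL-Library.Nat_Bijection"
begin

section \<open>Group presentations\<close>

text \<open>The letter \<open>(x, True)\<close> stands for \<open>x\<close> and \<open>(x, False)\<close> for its formal inverse.\<close>

type_synonym 'x letter = "'x \<times> bool"
type_synonym 'x word = "'x letter list"

definition letters :: "'x set \<Rightarrow> 'x letter set" where
  "letters X = X \<times> UNIV"

definition inv_letter :: "'x letter \<Rightarrow> 'x letter" where
  "inv_letter a = (fst a, \<not> snd a)"

definition inv_word :: "'x word \<Rightarrow> 'x word" where
  "inv_word w = rev (map inv_letter w)"

text \<open>
  Equality of words in the group presented by generators \<open>X\<close> and relators \<open>R\<close>: the least
  congruence on the free monoid over the letters of \<open>X\<close> which contains the free cancellations
  and identifies every relator with the empty word.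
\<close>

inductive_set pres_rel :: "'x set \<Rightarrow> 'x word set \<Rightarrow> ('x word \<times> 'x word) set"
  for X :: "'x set" and R :: "'x word set" where
  refl: "w \<in> lists (letters X) \<Longrightarrow> (w, w) \<in> pres_rel X R"
| sym: "(u, v) \<in> pres_rel X R \<Longrightarrow> (v, u) \<in> pres_rel X R"
| trans: "(u, v) \<in> pres_rel X R \<Longrightarrow> (v, w) \<in> pres_rel X R \<Longrightarrow> (u, w) \<in> pres_rel X R"
| cong: "(u, u') \<in> pres_rel X R \<Longrightarrow> (v, v') \<in> pres_rel X R \<Longrightarrow> (u @ v, u' @ v') \<in> pres_rel X R"
| cancel: "a \<in> letters X \<Longrightarrow> ([a, inv_letter a], []) \<in> pres_rel X R"
| relator: "r \<in> R \<Longrightarrow> r \<in> lists (letters X) \<Longrightarrow> (r, []) \<in> pres_rel X R"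

definition word_class :: "'x set \<Rightarrow> 'x word set \<Rightarrow> 'x word \<Rightarrow> 'x word set" where
  "word_class X R w = pres_rel X R `` {w}"

definition presented_group :: "'x set \<Rightarrow> 'x word set \<Rightarrow> 'x word set monoid" where
  "presented_group X R =
     \<lparr> carrier = lists (letters X) // pres_rel X R,
       mult = (\<lambda>C D. \<Union>u\<in>C. \<Union>v\<in>D. word_class X R (u @ v)),
       one = word_class X R [] \<rparr>"

lemma pres_rel_lists:
  "(u, v) \<in> pres_rel X R \<Longrightarrow> u \<in> lists (letters X) \<and> v \<in> lists (letters X)"
  by (induction rule: pres_rel.induct) (auto simp: letters_def inv_letter_def)

lemma equiv_pres_rel: "equiv (lists (letters X)) (pres_rel X R)"
proof (rule equivI)
  show "pres_rel X R \<subseteq> lists (letters X) \<times> lists (letters X)"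
    using pres_rel_lists by fast
  show "refl_on (lists (letters X)) (pres_rel X R)"
    by (auto intro: refl_onI pres_rel.refl)
  show "sym (pres_rel X R)" by (rule symI) (rule pres_rel.sym)
  show "trans (pres_rel X R)" by (rule transI) (rule pres_rel.trans)
qed

lemma word_class_eq_iff:
  assumes "u \<in> lists (letters X)" "v \<in> lists (letters X)"
  shows "word_class X R u = word_class X R v \<longleftrightarrow> (u, v) \<in> pres_rel X R"
  unfolding word_class_def using eq_equiv_class_iff[OF equiv_pres_rel assms] by simp

lemma carrier_presented_group:
  "carrier (presented_group X R) = word_class X R ` lists (letters X)"
  by (auto simp: presented_group_def quotient_def word_class_def)

lemma one_presented_group: "\<one>\<^bsub>presented_group X R\<^esub> = word_class X R []"
  by (simp add: presented_group_def)

lemma mult_presented_group: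
  assumes "u \<in> lists (letters X)" "v \<in> lists (letters X)"
  shows "word_class X R u \<otimes>\<^bsub>presented_group X R\<^esub> word_class X R v = word_class X R (u @ v)"
proof -
  have "word_class X R (u' @ v') = word_class X R (u @ v)"
    if "u' \<in> word_class X R u" "v' \<in> word_class X R v" for u' v'
  proof -
    have "(u @ v, u' @ v') \<in> pres_rel X R"
      using that by (auto simp: word_class_def intro: pres_rel.cong)
    then show ?thesis
      using pres_rel_lists word_class_eq_iff by metis
  qed
  moreover have "u \<in> word_class X R u" "v \<in> word_class X R v"
    using assms by (auto simp: word_class_def intro: pres_rel.refl)
  ultimately have "(\<Union>u'\<in>word_class X R u. \<Union>v'\<in>word_class X R v. word_class X R (u' @ v')) =
      word_class X R (u @ v)"
    by blast
  then show ?thesis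
    by (simp add: presented_group_def)
qed

lemma inv_word_lists: "w \<in> lists (letters X) \<Longrightarrow> inv_word w \<in> lists (letters X)"
  by (auto simp: inv_word_def letters_def inv_letter_def in_lists_conv_set)

lemma inv_word_cancel:
  "w \<in> lists (letters X) \<Longrightarrow> (inv_word w @ w, []) \<in> pres_rel X R"
proof (induction w)
  case Nil
  then show ?case by (auto simp: inv_word_def intro: pres_rel.refl)
next
  case (Cons a w)
  have a: "inv_letter a \<in> letters X" "inv_letter (inv_letter a) = a"
    and w: "w \<in> lists (letters X)"
    using Cons.prems by (auto simp: letters_def inv_letter_def)
  have "([inv_letter a, a], []) \<in> pres_rel X R"
    using pres_rel.cancel[OF a(1), of R] unfolding a(2) .
  note pres_rel.cong[OF this pres_rel.refl[OF w]]
  note pres_rel.cong[OF pres_rel.refl[OF inv_word_lists[OF w]] this]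
  then have "(inv_word w @ [inv_letter a, a] @ w, inv_word w @ w) \<in> pres_rel X R"
    by simp
  note pres_rel.trans[OF this Cons.IH[OF w]]
  then show ?case by (simp add: inv_word_def)
qed

lemma group_presented_group: "group (presented_group X R)"
proof (rule groupI)
  fix C assume "C \<in> carrier (presented_group X R)"
  then obtain w where w: "w \<in> lists (letters X)" "C = word_class X R w"
    unfolding carrier_presented_group by blast
  note w' = inv_word_lists[OF w(1)]
  have "word_class X R (inv_word w @ w) = word_class X R []"
    using pres_rel_lists word_class_eq_iff inv_word_cancel[OF w(1)] by metis
  then have "word_class X R (inv_word w) \<otimes>\<^bsub>presented_group X R\<^esub> C = \<one>\<^bsub>presented_group X R\<^esub>"
    unfolding w(2) one_presented_group mult_presented_group[OF w' w(1)] .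
  moreover have "word_class X R (inv_word w) \<in> carrier (presented_group X R)"
    unfolding carrier_presented_group using w' by (rule imageI)
  ultimately show "\<exists>D\<in>carrier (presented_group X R).
      D \<otimes>\<^bsub>presented_group X R\<^esub> C = \<one>\<^bsub>presented_group X R\<^esub>"
    by blast
next
  fix C D assume "C \<in> carrier (presented_group X R)" "D \<in> carrier (presented_group X R)"
  then obtain u v where u: "u \<in> lists (letters X)" "C = word_class X R u"
    and v: "v \<in> lists (letters X)" "D = word_class X R v"
    unfolding carrier_presented_group by blast
  from u(1) v(1) have "u @ v \<in> lists (letters X)" by simp
  then show "C \<otimes>\<^bsub>presented_group X R\<^esub> D \<in> carrier (presented_group X R)"
    unfolding u(2) v(2) mult_presented_group[OF u(1) v(1)] carrier_presented_group
    by (rule imageI)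
next
  fix C D E assume "C \<in> carrier (presented_group X R)" "D \<in> carrier (presented_group X R)"
    "E \<in> carrier (presented_group X R)"
  then obtain u v w where u: "u \<in> lists (letters X)" "C = word_class X R u"
    and v: "v \<in> lists (letters X)" "D = word_class X R v"
    and w: "w \<in> lists (letters X)" "E = word_class X R w"
    unfolding carrier_presented_group by blast
  from u(1) v(1) w(1) have uv: "u @ v \<in> lists (letters X)" and vw: "v @ w \<in> lists (letters X)"
    by simp_all
  show "(C \<otimes>\<^bsub>presented_group X R\<^esub> D) \<otimes>\<^bsub>presented_group X R\<^esub> E =
      C \<otimes>\<^bsub>presented_group X R\<^esub> (D \<otimes>\<^bsub>presented_group X R\<^esub> E)"
    unfolding u(2) v(2) w(2) mult_presented_group[OF u(1) v(1)] mult_presented_group[OF v(1) w(1)]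
      mult_presented_group[OF uv w(1)] mult_presented_group[OF u(1) vw] append_assoc ..
next
  have "[] \<in> lists (letters X)" by simp
  then show "\<one>\<^bsub>presented_group X R\<^esub> \<in> carrier (presented_group X R)"
    unfolding one_presented_group carrier_presented_group by (rule imageI)
next
  fix C assume "C \<in> carrier (presented_group X R)"
  then obtain w where w: "w \<in> lists (letters X)" "C = word_class X R w"
    unfolding carrier_presented_group by blast
  have "[] \<in> lists (letters X)" by simp
  from mult_presented_group[OF this w(1)]
  show "\<one>\<^bsub>presented_group X R\<^esub> \<otimes>\<^bsub>presented_group X R\<^esub> C = C"
    unfolding one_presented_group w(2) by simp
qed


section \<open>Free products with amalgamation\<close>

text \<open>
  The relation \<open>\<phi>1 a = \<phi>2 a\<close> between elements is turned into relators by letting \<open>u\<close> and \<open>v\<close>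
  range over all words representing its two sides; modulo \<open>R1\<close> and \<open>R2\<close> all these choices yield
  the same relation.
\<close>

definition amalgam_relators ::
    "'x word set \<Rightarrow> 'x word set \<Rightarrow> 'a set \<Rightarrow> ('a \<Rightarrow> 'x word set) \<Rightarrow> ('a \<Rightarrow> 'x word set) \<Rightarrow> 'x word set"
  where "amalgam_relators R1 R2 Y \<phi>1 \<phi>2 =
    R1 \<union> R2 \<union> {u @ inv_word v | u v a. a \<in> Y \<and> u \<in> \<phi>1 a \<and> v \<in> \<phi>2 a}"


section \<open>Algorithms\<close>

text \<open>
  Partial recursive functions. In \<open>PrimRec f g\<close> and \<open>Mu f\<close> the recursion (resp. search) variable
  is the first argument; \<open>g\<close> receives the counter, the previous value and the parameters.
\<close>

datatype recf =
    Zero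
  | Succ
  | Proj nat
  | Comp recf "recf list"
  | PrimRec recf recf
  | Mu recf

inductive rec_eval :: "recf \<Rightarrow> nat list \<Rightarrow> nat \<Rightarrow> bool" where
  Zero: "rec_eval Zero xs 0"
| Succ: "rec_eval Succ (x # xs) (Suc x)"
| Proj: "i < length xs \<Longrightarrow> rec_eval (Proj i) xs (xs ! i)"
| Comp: "list_all2 (\<lambda>g y. rec_eval g xs y) gs ys \<Longrightarrow> rec_eval f ys z \<Longrightarrow> rec_eval (Comp f gs) xs z"
| PrimRec_0: "rec_eval f xs y \<Longrightarrow> rec_eval (PrimRec f g) (0 # xs) y"
| PrimRec_Suc: "rec_eval (PrimRec f g) (n # xs) y \<Longrightarrow> rec_eval g (n # y # xs) z \<Longrightarrow>
    rec_eval (PrimRec f g) (Suc n # xs) z"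
| Mu: "rec_eval f (n # xs) 0 \<Longrightarrow> (\<And>m. m < n \<Longrightarrow> \<exists>y. rec_eval f (m # xs) (Suc y)) \<Longrightarrow>
    rec_eval (Mu f) xs n"

inductive_cases rec_eval_ZeroE: "rec_eval Zero xs z"
inductive_cases rec_eval_SuccE: "rec_eval Succ xs z"
inductive_cases rec_eval_ProjE: "rec_eval (Proj i) xs z"
inductive_cases rec_eval_CompE: "rec_eval (Comp f gs) xs z"
inductive_cases rec_eval_PrimRec_0E: "rec_eval (PrimRec f g) (0 # xs) z"
inductive_cases rec_eval_PrimRec_SucE: "rec_eval (PrimRec f g) (Suc n # xs) z"
inductive_cases rec_eval_MuE: "rec_eval (Mu f) xs z"

lemma rec_eval_deterministic: "rec_eval f xs y \<Longrightarrow> rec_eval f xs z \<Longrightarrow> y = z"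
proof (induction arbitrary: z rule: rec_eval.induct)
  case (Zero xs)
  then show ?case by (rule rec_eval_ZeroE) simp
next
  case (Succ x xs)
  then show ?case by (rule rec_eval_SuccE) simp
next
  case (Proj i xs)
  from Proj.prems show ?case by (rule rec_eval_ProjE) simp
next
  case (Comp xs gs ys f y)
  from Comp.prems obtain ys' where
    ys': "list_all2 (\<lambda>g y. rec_eval g xs y) gs ys'" "rec_eval f ys' z"
    by (rule rec_eval_CompE)
  have "ys ! i = ys' ! i" if "i < length gs" for i
    using Comp.IH(1) ys'(1) that unfolding list_all2_conv_all_nth by blast
  then have "ys = ys'"
    using Comp.IH(1) ys'(1) by (intro nth_equalityI) (simp_all add: list_all2_conv_all_nth)
  with Comp.IH(2) ys'(2) show ?case by blast
next
  case (PrimRec_0 f xs y g)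
  from PrimRec_0.prems show ?case by (rule rec_eval_PrimRec_0E) (rule PrimRec_0.IH)
next
  case (PrimRec_Suc f g n xs y w)
  from PrimRec_Suc.prems obtain y' where
    "rec_eval (PrimRec f g) (n # xs) y'" "rec_eval g (n # y' # xs) z"
    by (rule rec_eval_PrimRec_SucE)
  with PrimRec_Suc.IH show ?case by blast
next
  case (Mu f n xs)
  from Mu.prems have z: "rec_eval f (z # xs) 0" "\<And>m. m < z \<Longrightarrow> \<exists>y. rec_eval f (m # xs) (Suc y)"
    by (rule rec_eval_MuE, blast)+
  show ?case
  proof (rule linorder_cases[of n z])
    assume "n < z"
    with z(2) obtain y where "rec_eval f (n # xs) (Suc y)" by blast
    with Mu.IH(1) have "0 = Suc y" by blast
    then show ?thesis by simp
  next
    assume "z < n"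
    with Mu.IH(2) obtain y where "\<forall>x. rec_eval f (z # xs) x \<longrightarrow> Suc y = x" by blast
    with z(1) have "Suc y = 0" by blast
    then show ?thesis by simp
  qed
qed

text \<open>
  A tuple of words over an alphabet \<open>L\<close> is presented to an algorithm as the code number of a list
  of lists, based on a numbering \<open>e\<close> of the letters. A problem about such tuples is decidable if
  some partial recursive function halts on all of them and answers \<open>1\<close> or \<open>0\<close> according to whether
  it holds. The alphabets of interest are finite, so the choice of \<open>e\<close> is immaterial, and we
  ask for an algorithm for each of them.
\<close>

definition encode_tuple :: "('l \<Rightarrow> nat) \<Rightarrow> 'l list list \<Rightarrow> nat" where
  "encode_tuple e ws = list_encode (map (\<lambda>w. list_encode (map e w)) ws)"

definition decides :: "recf \<Rightarrow> ('l \<Rightarrow> nat) \<Rightarrow> 'l set \<Rightarrow> ('l list list \<Rightarrow> bool) \<Rightarrow> bool" where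
  "decides f e L P \<longleftrightarrow>
     (\<forall>ws \<in> lists (lists L). rec_eval f [encode_tuple e ws] (if P ws then 1 else 0))"

definition decidable_for_tuples :: "'l set \<Rightarrow> ('l list list \<Rightarrow> bool) \<Rightarrow> bool" where
  "decidable_for_tuples L P \<longleftrightarrow> (\<forall>e. inj_on e L \<longrightarrow> (\<exists>f. decides f e L P))"

end

theory Submission imports Defs begin

text \<open>
  A subgroup is trivial if and only if all its generators are, so the claim is that the word problem
  of \<open>G = G\<^sub>1 *\<^sub>A G\<^sub>2\<close> is decidable. The idea is to let \<open>G\<close> act from the right on a set of
  normal forms, in such a way that the action is easily computed and that the stabiliser of the empty
  normal form is trivial. A word then represents \<open>1\<close> exactly if it fixes the empty normal form
  (\<open>word_problem\<close>).

  The action is van der Waerden's. A normal form \<open>t\<^sub>n \<cdots> t\<^sub>1 a\<close> consists of an element \<open>a\<close> of \<open>A\<close> and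
  of representatives \<open>t\<^sub>k\<close> of nontrivial left cosets of \<open>A\<close>, taken alternately from the two factors.
  A factor acts by multiplying at the right end and restoring the normal form. Both factors induce the
  same action of \<open>A\<close> (\<open>act_\<phi>\<close>), so that the defining relators of \<open>G\<close> act trivially (\<open>relator_act\<close>) and
  words with the same class in \<open>G\<close> act in the same way (\<open>word_act_cong\<close>). Conversely, multiplying out
  a normal form in \<open>G\<close> is equivariant (\<open>ev_word_act\<close>); hence a word which fixes the empty normal form
  has class \<open>1\<close>.

  Multiplication by a letter changes \<open>a\<close> and at most the last syllable \<open>t\<^sub>1\<close>, after which it may put
  a new one (\<open>act_local\<close>). Since the groups are finite, the action of a word is thus a computation of
  a pushdown automaton, which has the elements of \<open>A\<close> as its states, keeps the syllables on its stack
  and is given by a finite table. Such a computation is recursive (\<open>total_rec_pushdown\<close>): a table is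
  a finite case distinction, and reading the input is a fold over a coded list.
\<close>

section \<open>Unary recursive functions\<close>

text \<open>
  Only unary functions are considered. Pairing and projections are themselves recursive, so
  several arguments and whole configurations of a machine can travel through one number.
\<close>

definition total_rec :: "(nat \<Rightarrow> nat) \<Rightarrow> bool" where
  "total_rec f \<longleftrightarrow> (\<exists>r. \<forall>x. rec_eval r [x] (f x))"

lemma rec_eval_Comp1: "rec_eval g xs y \<Longrightarrow> rec_eval f [y] z \<Longrightarrow> rec_eval (Comp f [g]) xs z"
  by (auto intro: rec_eval.Comp)

lemma rec_eval_Comp2:
  "rec_eval g xs y \<Longrightarrow> rec_eval h xs y' \<Longrightarrow> rec_eval f [y, y'] z \<Longrightarrow> rec_eval (Comp f [g, h]) xs z"
  by (auto intro: rec_eval.Comp)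

lemma rec_eval_Comp3:
  "rec_eval g xs y \<Longrightarrow> rec_eval h xs y' \<Longrightarrow> rec_eval k xs y'' \<Longrightarrow> rec_eval f [y, y', y''] z \<Longrightarrow>
    rec_eval (Comp f [g, h, k]) xs z"
  by (rule rec_eval.Comp[of _ _ "[y, y', y'']"]) simp_all

lemma rec_eval_Proj: "i < length xs \<Longrightarrow> y = xs ! i \<Longrightarrow> rec_eval (Proj i) xs y"
  by (simp add: rec_eval.Proj)

text \<open>
  Primitive recursion runs over the first argument; hence \<open>recf_minus\<close> takes the subtrahend first.
\<close>

definition "recf_plus = PrimRec (Proj 0) (Comp Succ [Proj 1])"
definition "recf_pred = PrimRec Zero (Proj 0)"
definition "recf_minus = PrimRec (Proj 0) (Comp recf_pred [Proj 1])"
definition "recf_triangle = PrimRec Zero (Comp Succ [Comp recf_plus [Proj 1, Proj 0]])"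
definition "recf_cond = PrimRec (Proj 0) (Proj 3)"

lemma recf_plus: "rec_eval recf_plus [m, n] (m + n)"
  unfolding recf_plus_def
  by (induction m) (auto intro!: rec_eval.intros(5-) rec_eval_Proj rec_eval_Comp1 rec_eval.Succ)

lemma recf_pred: "rec_eval recf_pred [m] (m - 1)"
  unfolding recf_pred_def
proof (induction m)
  case (Suc m)
  show ?case by (rule rec_eval.PrimRec_Suc[OF Suc.IH]) (simp add: rec_eval_Proj)
qed (auto intro: rec_eval.intros)

lemma recf_minus: "rec_eval recf_minus [n, m] (m - n)"
  unfolding recf_minus_def
proof (induction n)
  case (Suc n)
  have "rec_eval (Comp recf_pred [Proj 1]) [n, m - n, m] (m - n - 1)"
    by (rule rec_eval_Comp1[OF rec_eval_Proj recf_pred]) auto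
  then show ?case
    using rec_eval.PrimRec_Suc[OF Suc.IH] by simp
qed (auto intro!: rec_eval.PrimRec_0 rec_eval_Proj)

lemma recf_triangle: "rec_eval recf_triangle [n] (triangle n)"
  unfolding recf_triangle_def
proof (induction n)
  case (Suc n)
  have "rec_eval (Comp Succ [Comp recf_plus [Proj 1, Proj 0]]) [n, triangle n] (Suc (triangle n + n))"
    by (rule rec_eval_Comp1[OF rec_eval_Comp2[OF rec_eval_Proj rec_eval_Proj recf_plus] rec_eval.Succ]) auto
  then show ?case
    using rec_eval.PrimRec_Suc[OF Suc.IH] by simp
qed (auto intro: rec_eval.intros)

lemma recf_cond: "rec_eval recf_cond [c, a, b] (if c = 0 then a else b)"
  unfolding recf_cond_def
proof (induction c)
  case (Suc c)
  show ?case
    by (rule rec_eval.PrimRec_Suc[OF Suc.IH]) (simp add: rec_eval_Proj)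
qed (auto intro!: rec_eval.PrimRec_0 rec_eval_Proj)

named_theorems total_rec

lemma total_rec_id [total_rec]: "total_rec (\<lambda>x. x)"
  unfolding total_rec_def by (rule exI[of _ "Proj 0"]) (simp add: rec_eval_Proj)

lemma total_rec_const [total_rec]: "total_rec (\<lambda>x. c)"
proof (induction c)
  case 0
  show ?case unfolding total_rec_def by (blast intro: rec_eval.Zero)
next
  case (Suc c)
  then obtain r where "\<forall>x. rec_eval r [x] c" unfolding total_rec_def by blast
  then have "\<forall>x. rec_eval (Comp Succ [r]) [x] (Suc c)"
    by (blast intro: rec_eval_Comp1 rec_eval.Succ)
  then show ?case unfolding total_rec_def by blast
qed

lemma total_rec_comp: "total_rec f \<Longrightarrow> total_rec g \<Longrightarrow> total_rec (\<lambda>x. f (g x))"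
  unfolding total_rec_def by (blast intro: rec_eval_Comp1)

lemma total_rec_binary:
  assumes "\<And>x y. rec_eval r [x, y] (h x y)" "total_rec f" "total_rec g"
  shows "total_rec (\<lambda>x. h (f x) (g x))"
proof -
  from assms(2,3) obtain rf rg where "rec_eval rf [x] (f x)" "rec_eval rg [x] (g x)" for x
    unfolding total_rec_def by metis
  from rec_eval_Comp2[OF this assms(1)] show ?thesis unfolding total_rec_def by blast
qed

lemma total_rec_Suc [total_rec]: "total_rec f \<Longrightarrow> total_rec (\<lambda>x. Suc (f x))"
  unfolding total_rec_def by (blast intro: rec_eval_Comp1 rec_eval.Succ)

lemmas total_rec_plus [total_rec] = total_rec_binary[OF recf_plus]

lemma total_rec_minus [total_rec]:
  "total_rec f \<Longrightarrow> total_rec g \<Longrightarrow> total_rec (\<lambda>x. f x - g x)"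
  using total_rec_binary[OF recf_minus, of g f] .

lemma total_rec_triangle [total_rec]: "total_rec f \<Longrightarrow> total_rec (\<lambda>x. triangle (f x))"
  by (rule total_rec_comp[of triangle]) (auto simp: total_rec_def intro: recf_triangle)

lemma total_rec_if_zero:
  assumes "total_rec c" "total_rec f" "total_rec g"
  shows "total_rec (\<lambda>x. if c x = 0 then f x else g x)"
proof -
  from assms obtain rc rf rg where "rec_eval rc [x] (c x)" "rec_eval rf [x] (f x)"
    "rec_eval rg [x] (g x)" for x
    unfolding total_rec_def by metis
  from rec_eval_Comp3[OF this recf_cond] show ?thesis unfolding total_rec_def by blast
qed

lemma total_rec_if_eq [total_rec]:
  assumes "total_rec a" "total_rec b" "total_rec f" "total_rec g"
  shows "total_rec (\<lambda>x. if a x = b x then f x else g x)"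
proof -
  have "total_rec (\<lambda>x. (a x - b x) + (b x - a x))"
    by (intro total_rec assms)
  from total_rec_if_zero[OF this assms(3,4)] show ?thesis
    by (rule back_subst[of total_rec]) (auto simp: fun_eq_iff)
qed

text \<open>
  The projections of \<open>prod_decode\<close> amount to a search for the right diagonal; unbounded
  minimisation expresses this search directly.
\<close>

lemma total_rec_Least:
  assumes "\<And>x y. rec_eval r [y, x] (h y x)" and "\<And>x. \<exists>y. h y x = 0"
  shows "total_rec (\<lambda>x. LEAST y. h y x = 0)"
proof -
  have "rec_eval (Mu r) [x] (LEAST y. h y x = 0)" for x
  proof (rule rec_eval.Mu)
    have "h (LEAST y. h y x = 0) x = 0" by (rule LeastI_ex) (rule assms(2))
    then show "rec_eval r [LEAST y. h y x = 0, x] 0" by (metis assms(1))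
  next
    fix m assume "m < (LEAST y. h y x = 0)"
    then have "h m x \<noteq> 0" using not_less_Least by blast
    then show "\<exists>y. rec_eval r [m, x] (Suc y)" by (metis assms(1) not0_implies_Suc)
  qed
  then show ?thesis unfolding total_rec_def by blast
qed

abbreviation pair :: "nat \<Rightarrow> nat \<Rightarrow> nat" where "pair m n \<equiv> prod_encode (m, n)"
abbreviation pfst :: "nat \<Rightarrow> nat" where "pfst p \<equiv> fst (prod_decode p)"
abbreviation psnd :: "nat \<Rightarrow> nat" where "psnd p \<equiv> snd (prod_decode p)"

lemma total_rec_pair [total_rec]:
  "total_rec f \<Longrightarrow> total_rec g \<Longrightarrow> total_rec (\<lambda>x. pair (f x) (g x))"
  unfolding prod_encode_def by (simp add: total_rec)

lemma pair_pfst_psnd: "triangle (pfst p + psnd p) + pfst p = p"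
  using prod_decode_inverse[of p] by (simp add: prod_encode_def case_prod_beta)

lemma triangle_strict_mono: "m < n \<Longrightarrow> triangle m < triangle n"
  by (induction n) (auto simp: less_Suc_eq)

text \<open>
  Diagonal \<open>k\<close> of the Cantor numbering occupies the interval from \<open>triangle k\<close> up to, but excluding,
  \<open>triangle (Suc k)\<close>. Hence the diagonal \<open>pfst p + psnd p\<close> of \<open>p\<close> is the least \<open>k\<close> with
  \<open>p < triangle (Suc k)\<close>, and both projections can be read off from it.
\<close>

lemma prod_decode_sum: "(LEAST k. Suc p - triangle (Suc k) = 0) = pfst p + psnd p"
proof -
  define m n where "m = pfst p" and "n = psnd p"
  have p: "p = triangle (m + n) + m"
    by (simp add: m_def n_def pair_pfst_psnd)
  have "(LEAST k. Suc p - triangle (Suc k) = 0) = m + n"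
  proof (rule Least_equality)
    show "Suc p - triangle (Suc (m + n)) = 0" using p by simp
  next
    fix k assume k: "Suc p - triangle (Suc k) = 0"
    show "m + n \<le> k"
    proof (rule ccontr)
      assume "\<not> m + n \<le> k"
      then have "triangle (Suc k) \<le> triangle (m + n)"
        using triangle_strict_mono[of "Suc k" "m + n"] by (cases "Suc k = m + n") auto
      with k p show False by simp
    qed
  qed
  then show ?thesis by (simp add: m_def n_def)
qed

lemma total_rec_prod_sum: "total_rec (\<lambda>p. pfst p + psnd p)"
proof -
  let ?r = "Comp recf_minus [Comp recf_triangle [Comp Succ [Proj 0]], Comp Succ [Proj 1]]"
  have "rec_eval ?r [k, p] (Suc p - triangle (Suc k))" for k p
    by (rule rec_eval_Comp2[OF rec_eval_Comp1[OF rec_eval_Comp1[OF rec_eval_Proj rec_eval.Succ]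
          recf_triangle] rec_eval_Comp1[OF rec_eval_Proj rec_eval.Succ] recf_minus]) auto
  moreover have "\<exists>k. Suc p - triangle (Suc k) = 0" for p
    by (rule exI[of _ p]) simp
  ultimately show ?thesis
    using total_rec_Least[of ?r "\<lambda>k p. Suc p - triangle (Suc k)"] unfolding prod_decode_sum by blast
qed

lemma total_rec_pfst [total_rec]: "total_rec f \<Longrightarrow> total_rec (\<lambda>x. pfst (f x))"
proof (rule total_rec_comp[of pfst])
  have "total_rec (\<lambda>p. p - triangle (pfst p + psnd p))"
    by (intro total_rec total_rec_prod_sum)
  then show "total_rec pfst" 
    by (rule back_subst[of total_rec]) (metis add_diff_cancel_left' pair_pfst_psnd)
qed

lemma total_rec_psnd [total_rec]: "total_rec f \<Longrightarrow> total_rec (\<lambda>x. psnd (f x))"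
proof (rule total_rec_comp[of psnd])
  have "total_rec (\<lambda>p. (pfst p + psnd p) - pfst p)"
    by (intro total_rec total_rec_prod_sum)
  then show "total_rec psnd" by simp
qed

lemma total_rec_iterate:
  assumes "total_rec f"
  shows "total_rec (\<lambda>p. (f ^^ pfst p) (psnd p))"
proof -
  from assms obtain r where r: "rec_eval r [x] (f x)" for x
    unfolding total_rec_def by blast
  let ?it = "PrimRec (Proj 0) (Comp r [Proj 1])"
  have "rec_eval ?it [n, x] ((f ^^ n) x)" for n x
  proof (induction n)
    case (Suc n)
    have "rec_eval (Comp r [Proj 1]) [n, (f ^^ n) x, x] (f ((f ^^ n) x))"
      by (rule rec_eval_Comp1[OF rec_eval_Proj r]) auto
    then show ?case using rec_eval.PrimRec_Suc[OF Suc.IH] by simp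
  qed (auto intro!: rec_eval.PrimRec_0 rec_eval_Proj)
  from total_rec_binary[OF this] show ?thesis by (simp add: total_rec)
qed

lemma length_list_decode_le: "length (list_decode c) \<le> c"
proof (induction c rule: list_decode.induct)
  case (2 n)
  obtain x y where xy: "prod_decode n = (x, y)" by fastforce
  then have "y \<le> n" by (metis le_prod_encode_2 prod_decode_inverse)
  with 2[OF xy[symmetric]] xy show ?case by simp
qed simp

text \<open>
  A fold is an iteration on pairs (remaining list, accumulator), in which a state with an empty
  list is stationary. The number of rounds is the code of the list, an upper bound for its length.
\<close>

lemma total_rec_fold:
  assumes f: "total_rec f" and "total_rec c" "total_rec s"
  shows "total_rec (\<lambda>x. fold (\<lambda>a t. f (pair a t)) (list_decode (c x)) (s x))"
proof -
  define h where "h p = (if pfst p = 0 then p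
      else pair (psnd (pfst p - 1)) (f (pair (pfst (pfst p - 1)) (psnd p))))" for p
  have h: "total_rec h"
    unfolding h_def by (intro total_rec total_rec_comp[OF f])
  have "(h ^^ n) (pair (list_encode xs) t) = pair 0 (fold (\<lambda>a t. f (pair a t)) xs t)"
    if "length xs \<le> n" for n xs t
    using that
  proof (induction n arbitrary: xs t)
    case (Suc n)
    have nil: "h (pair 0 t) = pair 0 t" by (simp add: h_def)
    then have "(h ^^ n) (pair 0 t) = pair 0 t" by (induction n) auto
    moreover have "h (pair (list_encode (a # ys)) t) = pair (list_encode ys) (f (pair a t))" for a ys
      by (simp add: h_def)
    ultimately show ?case
      using Suc by (cases xs) (auto simp: funpow_Suc_right nil simp del: funpow.simps)
  qed simp
  from this[OF length_list_decode_le]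
  have "psnd ((h ^^ c x) (pair (c x) (s x))) = fold (\<lambda>a t. f (pair a t)) (list_decode (c x)) (s x)"
    for x by simp
  moreover have "total_rec (\<lambda>x. psnd ((h ^^ c x) (pair (c x) (s x))))"
    using total_rec_comp[OF total_rec_iterate[OF h], of "\<lambda>x. pair (c x) (pair (c x) (s x))"]
    by (simp add: total_rec assms)
  ultimately show ?thesis by simp
qed

text \<open>
  Consing onto a code is \<open>\<lambda>p. Suc p\<close> on the code of the pair of head and tail. Folding with it
  reverses the first list onto the empty one, and folding again returns it, in the right order,
  onto the second list.
\<close>

lemma total_rec_append:
  assumes "total_rec f" "total_rec g"
  shows "total_rec (\<lambda>x. list_encode (list_decode (f x) @ list_decode (g x)))"
proof -
  have cons: "total_rec (\<lambda>p. Suc p)" by (intro total_rec)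
  have *: "fold (\<lambda>a t. Suc (pair a t)) xs t = list_encode (rev xs @ list_decode t)" for xs t
    by (induction xs arbitrary: t) auto
  from total_rec_fold[OF cons total_rec_fold[OF cons assms(1) total_rec_const[of 0]] assms(2)]
  show ?thesis by (simp add: *)
qed

text \<open>
  This is how the fixed finite data enter the algorithm: the multiplication tables and coset
  representatives become part of the program, by way of any numbering \<open>c\<close> of their entries.
\<close>

lemma total_rec_table:
  assumes "finite S" "inj_on c S"
  shows "\<exists>g. total_rec g \<and> (\<forall>x\<in>S. g (c x) = f x)"
  using assms
proof (induction S rule: finite_induct)
  case empty
  show ?case using total_rec_id by auto
next
  case (insert y S)
  then obtain g where g: "total_rec g" "\<forall>x\<in>S. g (c x) = f x" by auto
  have "total_rec (\<lambda>n. if n = c y then f y else g n)"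
    by (intro total_rec g)
  moreover have "\<forall>x\<in>insert y S. (if c x = c y then f y else g (c x)) = f x"
    using insert g by (auto simp: inj_on_def)
  ultimately show ?case by blast
qed

section \<open>Decidability of pushdown computations\<close>

text \<open>
  A pushdown transition depends on the letter, the control state and at most the top of the stack.
  Over finite sets of letters, stack symbols and control states this is a finite table, whatever the
  nature of these objects; the rest of the stack is only carried along. The set \<open>C\<close> is an invariant
  of the machine which confines the symbols that can occur to finite sets.
\<close>

lemma total_rec_pushdown:
  fixes step :: "'l \<Rightarrow> 't list \<times> 'q \<Rightarrow> 't list \<times> 'q"
  assumes fin: "finite \<Lambda>" "finite \<Gamma>" "finite Q" and e: "inj_on e \<Lambda>"
    and C: "C \<subseteq> lists \<Gamma> \<times> Q" "([], q0) \<in> C"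
    and closed: "\<And>l \<omega>. l \<in> \<Lambda> \<Longrightarrow> \<omega> \<in> C \<Longrightarrow> step l \<omega> \<in> C"
    and local: "\<And>l L q. step l (L, q) = (case step l (take 1 L, q) of (L', q') \<Rightarrow> (L' @ drop 1 L, q'))"
  shows "\<exists>t. total_rec t \<and>
    (\<forall>w \<in> lists \<Lambda>. t (list_encode (map e w)) = (if fold step w ([], q0) = ([], q0) then 1 else 0))"
proof -
  obtain cQ :: "'q \<Rightarrow> nat" where cQ: "inj_on cQ Q"
    using finite_imp_inj_to_nat_seg[OF fin(3)] by blast
  obtain c\<Gamma> :: "'t \<Rightarrow> nat" where c\<Gamma>: "inj_on c\<Gamma> \<Gamma>"
    using finite_imp_inj_to_nat_seg[OF fin(2)] by blast
  define enc where "enc \<omega> = pair (cQ (snd \<omega>)) (list_encode (map c\<Gamma> (fst \<omega>)))" for \<omega>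
  have enc: "inj_on enc (lists \<Gamma> \<times> Q)"
  proof (rule inj_onI)
    fix \<omega> \<nu> assume *: "\<omega> \<in> lists \<Gamma> \<times> Q" "\<nu> \<in> lists \<Gamma> \<times> Q" "enc \<omega> = enc \<nu>"
    obtain L p M q where [simp]: "\<omega> = (L, p)" "\<nu> = (M, q)" by fastforce
    from * have mem: "L \<in> lists \<Gamma>" "M \<in> lists \<Gamma>" "p \<in> Q" "q \<in> Q"
      and eq: "enc (L, p) = enc (M, q)" by auto
    from eq have "cQ p = cQ q" "map c\<Gamma> L = map c\<Gamma> M" by (simp_all add: enc_def list_encode_eq)
    moreover have "inj_on c\<Gamma> (set L \<union> set M)"
      by (rule inj_on_subset[OF c\<Gamma>]) (use mem in auto)
    ultimately show "\<omega> = \<nu>"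
      using inj_onD[OF cQ] mem map_inj_on[of c\<Gamma> L M] by simp
  qed
  \<comment> \<open>The inputs of the table: configurations cut down to the part that a transition inspects.\<close>
  define tops where "tops = {L \<in> lists \<Gamma>. length L \<le> 1} \<times> Q"
  have "finite tops"
    unfolding tops_def using fin finite_lists_length_le[OF fin(2), of 1]
    by (simp add: lists_eq_set conj_commute)
  moreover have "inj_on (\<lambda>(l, \<omega>). pair (e l) (enc \<omega>)) (\<Lambda> \<times> tops)"
  proof (rule inj_onI)
    fix x y assume *: "x \<in> \<Lambda> \<times> tops" "y \<in> \<Lambda> \<times> tops"
      "(case x of (l, \<omega>) \<Rightarrow> pair (e l) (enc \<omega>)) = (case y of (l, \<omega>) \<Rightarrow> pair (e l) (enc \<omega>))"
    have "inj_on enc tops"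
      by (rule inj_on_subset[OF enc]) (auto simp: tops_def)
    then show "x = y"
      using * inj_onD[OF e, of "fst x" "fst y"] inj_onD[of enc tops "snd x" "snd y"]
      by (simp add: case_prod_beta mem_Times_iff prod_eq_iff)
  qed
  ultimately have "\<exists>g. total_rec g \<and> (\<forall>x\<in>\<Lambda> \<times> tops.
      g (case x of (l, \<omega>) \<Rightarrow> pair (e l) (enc \<omega>)) = enc (step (fst x) (snd x)))"
    by (intro total_rec_table finite_cartesian_product fin(1))
  then obtain g where g: "total_rec g"
    and g_eq: "\<And>l \<omega>. l \<in> \<Lambda> \<Longrightarrow> \<omega> \<in> tops \<Longrightarrow> g (pair (e l) (enc \<omega>)) = enc (step l \<omega>)"
    by auto
  define top where "top s = (if s = 0 then 0 else Suc (pair (pfst (s - 1)) 0))" for s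
  define pop where "pop s = (if s = 0 then 0 else psnd (s - 1))" for s
  have top: "top (list_encode xs) = list_encode (take 1 xs)"
    and pop: "list_decode (pop (list_encode xs)) = drop 1 xs" for xs
    by (cases xs; simp add: top_def pop_def)+
  define r where "r p = g (pair (pfst p) (pair (pfst (psnd p)) (top (psnd (psnd p)))))" for p
  define h where "h p = pair (pfst (r p))
    (list_encode (list_decode (psnd (r p)) @ list_decode (pop (psnd (psnd p)))))" for p
  have r: "total_rec r"
    unfolding r_def top_def by (intro total_rec total_rec_comp[OF g])
  have h: "total_rec h"
    unfolding h_def pop_def by (intro total_rec total_rec_append r)
  have h_eq: "h (pair (e l) (enc \<omega>)) = enc (step l \<omega>)" if "l \<in> \<Lambda>" "\<omega> \<in> C" for l \<omega>
  proof -
    obtain L q where \<omega>: "\<omega> = (L, q)" by fastforce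
    have "(take 1 L, q) \<in> tops"
      using that C(1) unfolding \<omega> tops_def by (auto dest: in_set_takeD)
    from g_eq[OF that(1) this]
    have "r (pair (e l) (enc \<omega>)) = enc (step l (take 1 L, q))"
      by (simp add: r_def enc_def \<omega> top take_map)
    then show ?thesis
      unfolding h_def local[of l L q] \<omega> by (simp add: enc_def pop drop_map split: prod.split)
  qed
  have run: "fold (\<lambda>a t. h (pair a t)) (map e w) (enc \<omega>) = enc (fold step w \<omega>) \<and> fold step w \<omega> \<in> C"
    if "w \<in> lists \<Lambda>" "\<omega> \<in> C" for w \<omega>
    using that by (induction w arbitrary: \<omega>) (auto simp: h_eq closed)
  define t where "t c = (if fold (\<lambda>a t. h (pair a t)) (list_decode c) (enc ([], q0)) = enc ([], q0)
    then 1 else 0 :: nat)" for c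
  have "total_rec t"
    unfolding t_def by (intro total_rec total_rec_fold h)
  moreover have "t (list_encode (map e w)) = (if fold step w ([], q0) = ([], q0) then 1 else 0)"
    if "w \<in> lists \<Lambda>" for w
    using run[OF that C(2)] inj_onD[OF enc, of "fold step w ([], q0)" "([], q0)"] C
    unfolding t_def by auto
  ultimately show ?thesis by blast
qed

text \<open>
  The words are checked one after the other, with an accumulator that starts at \<open>1\<close> and drops to
  \<open>0\<close> at the first failure.
\<close>

lemma decidable_for_tuples_all:
  assumes "\<And>e :: 'l \<Rightarrow> nat. inj_on e L \<Longrightarrow>
    \<exists>t. total_rec t \<and> (\<forall>w \<in> lists L. t (list_encode (map e w)) = (if P w then 1 else 0))"
  shows "decidable_for_tuples L (\<lambda>ws. \<forall>w\<in>set ws. P w)"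
  unfolding decidable_for_tuples_def
proof (intro allI impI)
  fix e :: "'l \<Rightarrow> nat" assume "inj_on e L"
  from assms[OF this] obtain t where t: "total_rec t"
    and t_eq: "\<And>w. w \<in> lists L \<Longrightarrow> t (list_encode (map e w)) = (if P w then 1 else 0)"
    by blast
  define f where "f p = (if t (pfst p) = 1 then psnd p else 0)" for p
  have f: "total_rec f"
    unfolding f_def by (intro total_rec total_rec_comp[OF t])
  have "total_rec (\<lambda>c. fold (\<lambda>a s. f (pair a s)) (list_decode c) 1)"
    by (intro total_rec_fold f total_rec)
  then obtain q where q: "rec_eval q [c] (fold (\<lambda>a s. f (pair a s)) (list_decode c) 1)" for c
    unfolding total_rec_def by blast
  have run: "fold (\<lambda>a s. f (pair a s)) (map (\<lambda>w. list_encode (map e w)) ws) s =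
      (if \<forall>w\<in>set ws. P w then s else 0)" if "ws \<in> lists (lists L)" for ws s
    using that by (induction ws arbitrary: s) (auto simp: f_def t_eq)
  have "rec_eval q [encode_tuple e ws] (if \<forall>w\<in>set ws. P w then 1 else 0)"
    if "ws \<in> lists (lists L)" for ws
    using q[of "encode_tuple e ws"] by (simp only: encode_tuple_def list_encode_inverse run[OF that])
  then have "decides q e L (\<lambda>ws. \<forall>w\<in>set ws. P w)"
    unfolding decides_def by blast
  then show "\<exists>q. decides q e L (\<lambda>ws. \<forall>w\<in>set ws. P w)" by blast
qed

section \<open>Normal forms in an amalgamated product\<close>

text \<open>
  The two factors are indexed by a truth value, so that everything is said once for both of them.
\<close>

locale amalgam =
  fixes F :: "bool \<Rightarrow> ('g, 'n) monoid_scheme"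
    and A :: "('a, 'm) monoid_scheme"
    and \<phi> :: "bool \<Rightarrow> 'a \<Rightarrow> 'g"
  assumes group_A: "group A"
    and group_F: "group (F i)"
    and mon: "\<phi> i \<in> mon A (F i)"
begin

sublocale A: group A by (rule group_A)
sublocale F: group "F i" for i by (rule group_F)
sublocale \<phi>: group_hom A "F i" "\<phi> i" for i
  using mon by unfold_locales (simp add: mon_def)

lemma inj_\<phi>: "inj_on (\<phi> i) (carrier A)"
  using mon by (simp add: mon_def)

definition amalgamated :: "bool \<Rightarrow> 'g set" where
  "amalgamated i = \<phi> i ` carrier A"

definition to_A :: "bool \<Rightarrow> 'g \<Rightarrow> 'a" where
  "to_A i = the_inv_into (carrier A) (\<phi> i)"

text \<open>
  Choosing from the coset of \<open>g\<close> makes the choice the same for all elements of this coset.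
\<close>

definition rep :: "bool \<Rightarrow> 'g \<Rightarrow> 'g" where
  "rep i g = (SOME h. h \<in> g <#\<^bsub>F i\<^esub> amalgamated i)"

lemma subgroup_amalgamated: "subgroup (amalgamated i) (F i)"
  unfolding amalgamated_def by (rule \<phi>.img_is_subgroup)

lemma \<phi>_amalgamated: "a \<in> carrier A \<Longrightarrow> \<phi> i a \<in> amalgamated i"
  unfolding amalgamated_def by (rule imageI)

lemma to_A_\<phi>: "a \<in> carrier A \<Longrightarrow> to_A i (\<phi> i a) = a"
  unfolding to_A_def by (rule the_inv_into_f_f[OF inj_\<phi>])

lemma to_A_closed: "g \<in> amalgamated i \<Longrightarrow> to_A i g \<in> carrier A"
  and \<phi>_to_A: "g \<in> amalgamated i \<Longrightarrow> \<phi> i (to_A i g) = g"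
  unfolding amalgamated_def by (auto simp: to_A_\<phi>)

lemma rep_coset:
  assumes "g \<in> carrier (F i)"
  obtains a where "a \<in> carrier A" "rep i g = g \<otimes>\<^bsub>F i\<^esub> \<phi> i a"
proof -
  have "g \<in> g <#\<^bsub>F i\<^esub> amalgamated i"
    using assms subgroup.one_closed[OF subgroup_amalgamated, of i]
    unfolding l_coset_def by force
  then have "rep i g \<in> g <#\<^bsub>F i\<^esub> amalgamated i"
    unfolding rep_def by (rule someI)
  then show ?thesis using that unfolding l_coset_def amalgamated_def by blast
qed

lemma rep_closed: "g \<in> carrier (F i) \<Longrightarrow> rep i g \<in> carrier (F i)"
  by (rule rep_coset[of g i]) auto

lemma rep_mult_\<phi>:
  assumes "g \<in> carrier (F i)" "a \<in> carrier A"
  shows "rep i (g \<otimes>\<^bsub>F i\<^esub> \<phi> i a) = rep i g"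
proof -
  have "g \<otimes>\<^bsub>F i\<^esub> \<phi> i a \<in> g <#\<^bsub>F i\<^esub> amalgamated i"
    using assms(2) unfolding l_coset_def amalgamated_def by blast
  then show ?thesis
    unfolding rep_def using F.l_repr_independence[OF _ assms(1) subgroup_amalgamated] by metis
qed

lemma inv_rep_mult:
  assumes "g \<in> carrier (F i)"
  shows "inv\<^bsub>F i\<^esub> rep i g \<otimes>\<^bsub>F i\<^esub> g \<in> amalgamated i"
proof -
  obtain a where a: "a \<in> carrier A" "rep i g = g \<otimes>\<^bsub>F i\<^esub> \<phi> i a"
    using rep_coset[OF assms] .
  then have "inv\<^bsub>F i\<^esub> rep i g \<otimes>\<^bsub>F i\<^esub> g = \<phi> i (inv\<^bsub>A\<^esub> a)"
    using assms by (simp add: F.inv_mult_group F.m_assoc)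
  with a(1) show ?thesis by (simp add: \<phi>_amalgamated del: \<phi>.hom_inv)
qed

lemma mult_amalgamated_iff:
  assumes "g \<in> carrier (F i)" "a \<in> carrier A"
  shows "g \<otimes>\<^bsub>F i\<^esub> \<phi> i a \<in> amalgamated i \<longleftrightarrow> g \<in> amalgamated i"
proof
  assume "g \<otimes>\<^bsub>F i\<^esub> \<phi> i a \<in> amalgamated i"
  then have "(g \<otimes>\<^bsub>F i\<^esub> \<phi> i a) \<otimes>\<^bsub>F i\<^esub> \<phi> i (inv\<^bsub>A\<^esub> a) \<in> amalgamated i"
    by (rule subgroup.m_closed[OF subgroup_amalgamated])
      (simp add: \<phi>_amalgamated assms del: \<phi>.hom_inv)
  then show "g \<in> amalgamated i" using assms by (simp add: F.m_assoc)
next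
  assume "g \<in> amalgamated i"
  then show "g \<otimes>\<^bsub>F i\<^esub> \<phi> i a \<in> amalgamated i"
    by (rule subgroup.m_closed[OF subgroup_amalgamated]) (simp add: \<phi>_amalgamated assms)
qed

text \<open>
  A normal form \<open>([(i\<^sub>1, t\<^sub>1), \<dots>, (i\<^sub>n, t\<^sub>n)], a)\<close> stands for the product
  \<open>t\<^sub>n \<cdots> t\<^sub>1 a\<close>: its syllables \<open>t\<^sub>k\<close> are chosen representatives of nontrivial left cosets of \<open>A\<close>,
  taken alternately from the two factors. The syllable next to \<open>a\<close> is at the head of the list, since
  the groups act by multiplication on the right and change the product only at that end.
\<close>

definition avoids :: "bool \<Rightarrow> (bool \<times> 'g) list \<Rightarrow> bool" where
  "avoids i L \<longleftrightarrow> (L = [] \<or> fst (hd L) \<noteq> i)"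

fun reduced :: "(bool \<times> 'g) list \<Rightarrow> bool" where
  "reduced [] \<longleftrightarrow> True"
| "reduced ((i, t) # L) \<longleftrightarrow>
     t \<in> carrier (F i) \<and> t \<notin> amalgamated i \<and> rep i t = t \<and> avoids i L \<and> reduced L"

definition normal_forms :: "((bool \<times> 'g) list \<times> 'a) set" where
  "normal_forms = Collect reduced \<times> carrier A"

text \<open>
  The normal forms are in bijection with the pairs in \<open>exposed i\<close>, where a pair \<open>(L, g)\<close> stands for
  the product of the syllables of \<open>L\<close>, the last of which is not from factor \<open>i\<close>, and an element \<open>g\<close>
  of factor \<open>i\<close>: \<open>expose i\<close> merges \<open>a\<close> with the last syllable if this is from factor \<open>i\<close>, and \<open>absorb i\<close> undoes this
  by splitting \<open>g\<close> into a coset representative and an element of \<open>A\<close>. Through this bijection, factor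
  \<open>i\<close> acts on normal forms by right multiplication of the second component, which is obviously an
  action.
\<close>

fun expose :: "bool \<Rightarrow> (bool \<times> 'g) list \<times> 'a \<Rightarrow> (bool \<times> 'g) list \<times> 'g" where
  "expose i ([], a) = ([], \<phi> i a)"
| "expose i ((j, t) # L, a) =
     (if j = i then (L, t \<otimes>\<^bsub>F i\<^esub> \<phi> i a) else ((j, t) # L, \<phi> i a))"

fun absorb :: "bool \<Rightarrow> (bool \<times> 'g) list \<times> 'g \<Rightarrow> (bool \<times> 'g) list \<times> 'a" where
  "absorb i (L, g) = (if g \<in> amalgamated i then (L, to_A i g)
     else ((i, rep i g) # L, to_A i (inv\<^bsub>F i\<^esub> rep i g \<otimes>\<^bsub>F i\<^esub> g)))"

definition act :: "bool \<Rightarrow> 'g \<Rightarrow> (bool \<times> 'g) list \<times> 'a \<Rightarrow> (bool \<times> 'g) list \<times> 'a" where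
  "act i g \<omega> = (case expose i \<omega> of (L, h) \<Rightarrow> absorb i (L, h \<otimes>\<^bsub>F i\<^esub> g))"

definition exposed :: "bool \<Rightarrow> ((bool \<times> 'g) list \<times> 'g) set" where
  "exposed i = {L. reduced L \<and> avoids i L} \<times> carrier (F i)"

lemma expose_closed: "\<omega> \<in> normal_forms \<Longrightarrow> expose i \<omega> \<in> exposed i"
  by (induction i \<omega> rule: expose.induct) (auto simp: normal_forms_def exposed_def avoids_def)

lemma absorb_closed: "p \<in> exposed i \<Longrightarrow> absorb i p \<in> normal_forms"
proof (induction i p rule: absorb.induct)
  case (1 i L g)
  then have g: "g \<in> carrier (F i)" and L: "reduced L" "avoids i L" by (auto simp: exposed_def)
  obtain a where a: "a \<in> carrier A" "rep i g = g \<otimes>\<^bsub>F i\<^esub> \<phi> i a"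
    using rep_coset[OF g] .
  then have "rep i (rep i g) = rep i g" and "rep i g \<in> amalgamated i \<longleftrightarrow> g \<in> amalgamated i"
    using g by (simp_all add: rep_mult_\<phi> mult_amalgamated_iff)
  then show ?case
    using g L by (simp add: normal_forms_def to_A_closed inv_rep_mult rep_closed)
qed

lemma absorb_expose: "\<omega> \<in> normal_forms \<Longrightarrow> absorb i (expose i \<omega>) = \<omega>"
proof (induction i \<omega> rule: expose.induct)
  case (2 i j t L a)
  then have t: "t \<in> carrier (F j)" "t \<notin> amalgamated j" "rep j t = t" and a: "a \<in> carrier A"
    by (auto simp: normal_forms_def)
  then have "inv\<^bsub>F j\<^esub> t \<otimes>\<^bsub>F j\<^esub> (t \<otimes>\<^bsub>F j\<^esub> \<phi> j a) = \<phi> j a"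
    by (simp add: F.inv_solve_left')
  then show ?case
    using t a by (cases "j = i") (simp_all add: mult_amalgamated_iff rep_mult_\<phi> to_A_\<phi> \<phi>_amalgamated)
qed (auto simp: normal_forms_def to_A_\<phi> \<phi>_amalgamated)

lemma expose_absorb: "p \<in> exposed i \<Longrightarrow> expose i (absorb i p) = p"
proof (induction i p rule: absorb.induct)
  case (1 i L g)
  then have g: "g \<in> carrier (F i)" and L: "avoids i L" by (auto simp: exposed_def)
  show ?case
  proof (cases "g \<in> amalgamated i")
    case True
    then show ?thesis using L by (cases L) (auto simp: avoids_def \<phi>_to_A)
  next
    case False
    have "rep i g \<otimes>\<^bsub>F i\<^esub> (inv\<^bsub>F i\<^esub> rep i g \<otimes>\<^bsub>F i\<^esub> g) = g"
      using g rep_closed[OF g] by (simp add: F.m_assoc[symmetric])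
    then show ?thesis using False g by (simp add: \<phi>_to_A inv_rep_mult)
  qed
qed

lemma exposed_mult:
  "(L, h) \<in> exposed i \<Longrightarrow> g \<in> carrier (F i) \<Longrightarrow> (L, h \<otimes>\<^bsub>F i\<^esub> g) \<in> exposed i"
  by (auto simp: exposed_def)

lemma act_closed: "\<omega> \<in> normal_forms \<Longrightarrow> g \<in> carrier (F i) \<Longrightarrow> act i g \<omega> \<in> normal_forms"
  using expose_closed[of \<omega> i] unfolding act_def
  by (auto split: prod.split simp del: absorb.simps intro!: absorb_closed exposed_mult)

lemma act_one:
  assumes "\<omega> \<in> normal_forms"
  shows "act i \<one>\<^bsub>F i\<^esub> \<omega> = \<omega>"
proof -
  obtain L h where Lh: "expose i \<omega> = (L, h)" by fastforce
  then have "h \<in> carrier (F i)" using expose_closed[OF assms, of i] by (simp add: exposed_def)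
  then show ?thesis
    unfolding act_def using Lh absorb_expose[OF assms, of i] by (simp del: absorb.simps)
qed

lemma act_mult:
  assumes "\<omega> \<in> normal_forms" "g \<in> carrier (F i)" "h \<in> carrier (F i)"
  shows "act i h (act i g \<omega>) = act i (g \<otimes>\<^bsub>F i\<^esub> h) \<omega>"
proof -
  obtain L k where Lk: "expose i \<omega> = (L, k)" by fastforce
  then have "(L, k) \<in> exposed i" using expose_closed[OF assms(1), of i] by simp
  then have "k \<in> carrier (F i)" "expose i (absorb i (L, k \<otimes>\<^bsub>F i\<^esub> g)) = (L, k \<otimes>\<^bsub>F i\<^esub> g)"
    using assms by (auto intro!: expose_absorb exposed_mult simp: exposed_def simp del: absorb.simps)
  then show ?thesis
    unfolding act_def using Lk assms by (simp add: F.m_assoc del: absorb.simps)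
qed

text \<open>
  The two actions agree on \<open>A\<close>, because in both of them an element of \<open>A\<close> multiplies the last
  component and does not touch the syllables. Together they therefore are an action of the
  amalgamated product.
\<close>

lemma act_\<phi>:
  assumes "(L, a) \<in> normal_forms" "b \<in> carrier A"
  shows "act i (\<phi> i b) (L, a) = (L, a \<otimes>\<^bsub>A\<^esub> b)"
proof -
  have a: "a \<in> carrier A" using assms by (simp add: normal_forms_def)
  have "(L, a \<otimes>\<^bsub>A\<^esub> b) \<in> normal_forms" using assms by (simp add: normal_forms_def)
  note absorb_expose[OF this, of i, symmetric]
  also have "absorb i (expose i (L, a \<otimes>\<^bsub>A\<^esub> b)) = act i (\<phi> i b) (L, a)"
    using assms a unfolding act_def
    by (cases L) (auto simp: normal_forms_def F.m_assoc simp del: absorb.simps)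
  finally show ?thesis by simp
qed

text \<open>
  Only the syllable at the head of the list can merge with the factor, so the action is a pushdown
  transition.
\<close>

lemma act_local:
  "act i g (L, a) = (case act i g (take 1 L, a) of (L', b) \<Rightarrow> (L' @ drop 1 L, b))"
  unfolding act_def by (cases L) auto

end

section \<open>Evaluating normal forms in a target group\<close>

text \<open>
  A group \<open>G\<close> in which the two factors are mapped compatibly. Normal forms can be multiplied out in
  \<open>G\<close>, and this turns the action on normal forms into right multiplication. It is the half of the
  argument which shows that a word fixing the empty normal form is trivial in \<open>G\<close>.
\<close>

locale amalgam_hom = amalgam F A \<phi> + G: group G
  for F :: "bool \<Rightarrow> ('g, 'n) monoid_scheme"
    and A :: "('a, 'm) monoid_scheme"
    and \<phi> :: "bool \<Rightarrow> 'a \<Rightarrow> 'g"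
    and G :: "('h, 'o) monoid_scheme" +
  fixes \<iota> :: "bool \<Rightarrow> 'g \<Rightarrow> 'h"
  assumes hom: "\<iota> i \<in> hom (F i) G"
    and agree: "a \<in> carrier A \<Longrightarrow> \<iota> i (\<phi> i a) = \<iota> j (\<phi> j a)"
begin

sublocale \<iota>: group_hom "F i" G "\<iota> i" for i
  using hom by unfold_locales

fun ev_stack :: "(bool \<times> 'g) list \<Rightarrow> 'h" where
  "ev_stack [] = \<one>\<^bsub>G\<^esub>"
| "ev_stack ((i, t) # L) = ev_stack L \<otimes>\<^bsub>G\<^esub> \<iota> i t"

definition ev :: "(bool \<times> 'g) list \<times> 'a \<Rightarrow> 'h" where
  "ev \<omega> = ev_stack (fst \<omega>) \<otimes>\<^bsub>G\<^esub> \<iota> True (\<phi> True (snd \<omega>))"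

lemma ev_stack_closed: "reduced L \<Longrightarrow> ev_stack L \<in> carrier G"
  by (induction L rule: ev_stack.induct) auto

lemma ev_closed: "\<omega> \<in> normal_forms \<Longrightarrow> ev \<omega> \<in> carrier G"
  by (auto simp: ev_def normal_forms_def ev_stack_closed)

lemma ev_expose:
  "(L, a) \<in> normal_forms \<Longrightarrow>
    ev (L, a) = ev_stack (fst (expose i (L, a))) \<otimes>\<^bsub>G\<^esub> \<iota> i (snd (expose i (L, a)))"
  unfolding ev_def
  by (induction i "(L, a)" rule: expose.induct)
    (auto simp: normal_forms_def G.m_assoc ev_stack_closed agree[of _ True])

lemma ev_act:
  assumes "\<omega> \<in> normal_forms" "g \<in> carrier (F i)"
  shows "ev (act i g \<omega>) = ev \<omega> \<otimes>\<^bsub>G\<^esub> \<iota> i g"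
proof -
  obtain L h where Lh: "expose i \<omega> = (L, h)" by fastforce
  then have ex: "(L, h) \<in> exposed i" using expose_closed[OF assms(1), of i] by simp
  then have "(L, h \<otimes>\<^bsub>F i\<^esub> g) \<in> exposed i" using assms(2) by (rule exposed_mult)
  then have "ev (absorb i (L, h \<otimes>\<^bsub>F i\<^esub> g)) = ev_stack L \<otimes>\<^bsub>G\<^esub> \<iota> i (h \<otimes>\<^bsub>F i\<^esub> g)"
    using ev_expose[of _ _ i] absorb_closed expose_absorb by (metis fst_conv snd_conv prod.exhaust)
  also have "\<dots> = (ev_stack L \<otimes>\<^bsub>G\<^esub> \<iota> i h) \<otimes>\<^bsub>G\<^esub> \<iota> i g"
    using ex assms(2) by (simp add: exposed_def ev_stack_closed G.m_assoc)
  also have "ev_stack L \<otimes>\<^bsub>G\<^esub> \<iota> i h = ev \<omega>"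
    using ev_expose[of "fst \<omega>" "snd \<omega>" i] assms(1) Lh by simp
  finally show ?thesis unfolding act_def Lh by simp
qed

end

section \<open>Presented groups\<close>

lemma pres_rel_mono: "(u, v) \<in> pres_rel X R \<Longrightarrow> X \<subseteq> X' \<Longrightarrow> R \<subseteq> R' \<Longrightarrow> (u, v) \<in> pres_rel X' R'"
proof (induction rule: pres_rel.induct)
  case (trans u v w)
  then show ?case by (blast intro: pres_rel.trans)
next
  case (cancel l)
  then show ?case by (intro pres_rel.cancel) (auto simp: letters_def)
next
  case (relator r)
  then show ?case by (intro pres_rel.relator) (auto simp: letters_def)
next
  case (refl w)
  then show ?case by (intro pres_rel.refl) (auto simp: letters_def)
qed (blast intro: pres_rel.intros)+

lemma word_class_eqI: "(u, v) \<in> pres_rel X R \<Longrightarrow> word_class X R u = word_class X R v"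
  using pres_rel_lists word_class_eq_iff by metis

lemma presented_group_memberE:
  assumes "C \<in> carrier (presented_group X R)" "w \<in> C"
  shows "w \<in> lists (letters X)" "C = word_class X R w"
proof -
  obtain u where u: "u \<in> lists (letters X)" "C = word_class X R u"
    using assms(1) unfolding carrier_presented_group by blast
  then have "(u, w) \<in> pres_rel X R" using assms(2) by (simp add: word_class_def)
  then show "w \<in> lists (letters X)" "C = word_class X R w"
    using pres_rel_lists word_class_eqI u(2) by blast+
qed

lemma word_class_closed:
  "w \<in> lists (letters X) \<Longrightarrow> word_class X R w \<in> carrier (presented_group X R)"
  unfolding carrier_presented_group by (rule imageI)

lemma inv_word_class:
  assumes "w \<in> lists (letters X)"
  shows "inv\<^bsub>presented_group X R\<^esub> word_class X R w = word_class X R (inv_word w)"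
proof (rule group.inv_equality[OF group_presented_group])
  show "word_class X R (inv_word w) \<otimes>\<^bsub>presented_group X R\<^esub> word_class X R w =
      \<one>\<^bsub>presented_group X R\<^esub>"
    using assms by (simp add: mult_presented_group inv_word_lists one_presented_group
        word_class_eqI[OF inv_word_cancel])
qed (simp_all add: assms word_class_closed inv_word_lists)

lemma (in group) generate_eq_one_iff:
  "S \<subseteq> carrier G \<Longrightarrow> generate G S = {\<one>} \<longleftrightarrow> (\<forall>s\<in>S. s = \<one>)"
  using generate.incl[of _ S G] generate.one[of G S]
    generate_subgroup_incl[OF _ triv_subgroup, of S] by auto

section \<open>Words acting on normal forms\<close>

locale amalgam_presentation =
  fixes X :: "bool \<Rightarrow> 'x set"
    and R :: "bool \<Rightarrow> 'x word set"
    and A :: "('a, 'm) monoid_scheme"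
    and Y :: "'a set"
    and \<phi> :: "bool \<Rightarrow> 'a \<Rightarrow> 'x word set"
  assumes disjoint: "letters (X True) \<inter> letters (X False) = {}"
    and relators: "R i \<subseteq> lists (letters (X i))"
    and group_A: "group A"
    and Y: "Y \<subseteq> carrier A" "generate A Y = carrier A"
    and mon: "\<phi> i \<in> mon A (presented_group (X i) (R i))"
begin

abbreviation XX :: "'x set" where "XX \<equiv> X True \<union> X False"
abbreviation RR :: "'x word set" where
  "RR \<equiv> amalgam_relators (R True) (R False) Y (\<phi> True) (\<phi> False)"
abbreviation F :: "bool \<Rightarrow> 'x word set monoid" where "F i \<equiv> presented_group (X i) (R i)"
abbreviation G :: "'x word set monoid" where "G \<equiv> presented_group XX RR"

text \<open>
  The class of a word in a factor is contained in its class in the amalgamated product; \<open>\<iota>\<close>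
  enlarges the former to the latter.
\<close>

definition \<iota> :: "bool \<Rightarrow> 'x word set \<Rightarrow> 'x word set" where
  "\<iota> i C = pres_rel XX RR `` C"

sublocale amalgam F A \<phi>
  by (rule amalgam.intro) (rule group_A group_presented_group mon)+

lemma letters_XX: "l \<in> letters (X i) \<Longrightarrow> l \<in> letters XX"
  by (cases i) (auto simp: letters_def)

lemma words_XX: "w \<in> lists (letters (X i)) \<Longrightarrow> w \<in> lists (letters XX)"
  using letters_XX by auto

lemma \<iota>_word_class:
  assumes "w \<in> lists (letters (X i))"
  shows "\<iota> i (word_class (X i) (R i) w) = word_class XX RR w"
proof -
  have sub: "X i \<subseteq> XX" "R i \<subseteq> RR" by (cases i; auto simp: amalgam_relators_def)+
  have "(w, w) \<in> pres_rel (X i) (R i)" using assms by (rule pres_rel.refl)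
  then show ?thesis
    unfolding \<iota>_def word_class_def using pres_rel_mono[OF _ sub]
    by (auto intro: pres_rel.trans)
qed

lemma \<iota>_hom: "\<iota> i \<in> hom (F i) G"
proof (rule homI)
  fix C assume "C \<in> carrier (F i)"
  then obtain w where w: "w \<in> lists (letters (X i))" "C = word_class (X i) (R i) w"
    unfolding carrier_presented_group by blast
  then show "\<iota> i C \<in> carrier G"
    using word_class_closed[OF words_XX[OF w(1)]] by (simp only: \<iota>_word_class)
next
  fix C D assume "C \<in> carrier (F i)" "D \<in> carrier (F i)"
  then obtain u v where u: "u \<in> lists (letters (X i))" "C = word_class (X i) (R i) u"
    and v: "v \<in> lists (letters (X i))" "D = word_class (X i) (R i) v"
    unfolding carrier_presented_group by blast
  have "u @ v \<in> lists (letters (X i))" using u(1) v(1) by simp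
  then show "\<iota> i (C \<otimes>\<^bsub>F i\<^esub> D) = \<iota> i C \<otimes>\<^bsub>G\<^esub> \<iota> i D"
    unfolding u(2) v(2) mult_presented_group[OF u(1) v(1)]
    by (simp only: \<iota>_word_class u(1) v(1) mult_presented_group[OF words_XX[OF u(1)] words_XX[OF v(1)]])
qed

lemma \<phi>_words:
  assumes "a \<in> carrier A"
  obtains w where "w \<in> \<phi> i a" "w \<in> lists (letters (X i))" "\<phi> i a = word_class (X i) (R i) w"
proof -
  have "\<phi> i a \<in> carrier (F i)" using assms by simp
  then obtain w where w: "w \<in> lists (letters (X i))" "\<phi> i a = word_class (X i) (R i) w"
    unfolding carrier_presented_group by blast
  have "w \<in> \<phi> i a" unfolding w(2) word_class_def using w(1) by (auto intro: pres_rel.refl)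
  with w that show ?thesis by blast
qed

text \<open>
  From the relator \<open>u v\<^sup>-\<^sup>1\<close> the equality of \<open>u\<close> and \<open>v\<close> follows by way of the word \<open>u v\<^sup>-\<^sup>1 v\<close>.
\<close>

lemma \<iota>_\<phi>_generator:
  assumes "a \<in> Y"
  shows "\<iota> True (\<phi> True a) = \<iota> False (\<phi> False a)"
proof -
  have a: "a \<in> carrier A" using assms Y(1) by blast
  obtain u where u: "u \<in> \<phi> True a" "u \<in> lists (letters (X True))"
    "\<phi> True a = word_class (X True) (R True) u" using \<phi>_words[OF a] .
  obtain v where v: "v \<in> \<phi> False a" "v \<in> lists (letters (X False))"
    "\<phi> False a = word_class (X False) (R False) v" using \<phi>_words[OF a] .
  note u' = words_XX[OF u(2)] and v' = words_XX[OF v(2)]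
  have "u @ inv_word v \<in> RR" using assms u(1) v(1) by (auto simp: amalgam_relators_def)
  then have "(u @ inv_word v, []) \<in> pres_rel XX RR"
    using u' inv_word_lists[OF v'] by (intro pres_rel.relator) simp_all
  from pres_rel.cong[OF this pres_rel.refl[OF v']]
  have 1: "(u @ inv_word v @ v, v) \<in> pres_rel XX RR" by simp
  from pres_rel.cong[OF pres_rel.refl[OF u'] inv_word_cancel[OF v']]
  have "(u @ inv_word v @ v, u) \<in> pres_rel XX RR" by simp
  from pres_rel.trans[OF pres_rel.sym[OF this] 1]
  show ?thesis
    unfolding u(3) v(3) \<iota>_word_class[OF u(2)] \<iota>_word_class[OF v(2)] by (rule word_class_eqI)
qed

sublocale G: group G by (rule group_presented_group)

lemma \<iota>_\<phi>:
  assumes "a \<in> carrier A"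
  shows "\<iota> True (\<phi> True a) = \<iota> False (\<phi> False a)"
proof -
  have "\<iota> i \<circ> \<phi> i \<in> hom A G" for i
    by (rule hom_compose[OF \<phi>.homh \<iota>_hom])
  then interpret \<psi>: group_hom A G "\<iota> i \<circ> \<phi> i" for i
    by unfold_locales
  have "a \<in> generate A Y" using assms Y(2) by simp
  then have "(\<iota> True \<circ> \<phi> True) a = (\<iota> False \<circ> \<phi> False) a"
  proof (induction rule: generate.induct)
    case (incl h)
    then show ?case by (simp add: \<iota>_\<phi>_generator)
  next
    case (inv h)
    then have "h \<in> carrier A" "(\<iota> True \<circ> \<phi> True) h = (\<iota> False \<circ> \<phi> False) h"
      using Y(1) by (auto simp: \<iota>_\<phi>_generator)
    then show ?case by (simp only: \<psi>.hom_inv)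
  next
    case (eng g h)
    then have "g \<in> carrier A" "h \<in> carrier A" using Y(2) by simp_all
    with eng.IH show ?case by (simp only: \<psi>.hom_mult)
  next
    case one
    show ?case by (simp only: \<psi>.hom_one)
  qed
  then show ?thesis by simp
qed

sublocale amalgam_hom F A \<phi> G \<iota>
proof (rule amalgam_hom.intro[OF amalgam_axioms G.is_group amalgam_hom_axioms.intro])
  show "\<iota> i (\<phi> i a) = \<iota> j (\<phi> j a)" if "a \<in> carrier A" for a i j
    using \<iota>_\<phi>[OF that] by (cases i; cases j) simp_all
qed (rule \<iota>_hom)

definition side :: "'x letter \<Rightarrow> bool" where "side l \<longleftrightarrow> fst l \<in> X True"

definition letter_act ::
    "'x letter \<Rightarrow> (bool \<times> 'x word set) list \<times> 'a \<Rightarrow> (bool \<times> 'x word set) list \<times> 'a" where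
  "letter_act l = act (side l) (word_class (X (side l)) (R (side l)) [l])"

lemma side_eq: "l \<in> letters (X i) \<Longrightarrow> side l = i"
  using disjoint by (cases i) (auto simp: letters_def side_def)

lemma side_letters: "l \<in> letters XX \<Longrightarrow> l \<in> letters (X (side l))"
  using disjoint by (cases "side l") (auto simp: letters_def side_def)

lemma letter_act_closed:
  "l \<in> letters XX \<Longrightarrow> \<omega> \<in> normal_forms \<Longrightarrow> letter_act l \<omega> \<in> normal_forms"
  unfolding letter_act_def by (rule act_closed) (simp_all add: word_class_closed side_letters)

lemma word_act_closed:
  "w \<in> lists (letters XX) \<Longrightarrow> \<omega> \<in> normal_forms \<Longrightarrow> fold letter_act w \<omega> \<in> normal_forms"
  by (induction w arbitrary: \<omega>) (auto simp: letter_act_closed)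

lemma word_act_factor:
  "w \<in> lists (letters (X i)) \<Longrightarrow> \<omega> \<in> normal_forms \<Longrightarrow>
    fold letter_act w \<omega> = act i (word_class (X i) (R i) w) \<omega>"
proof (induction w arbitrary: \<omega>)
  case Nil
  then show ?case using act_one[of \<omega> i] by (simp add: one_presented_group)
next
  case (Cons l w)
  then have l: "[l] \<in> lists (letters (X i))" "side l = i" and w: "w \<in> lists (letters (X i))"
    by (auto simp: side_eq)
  have "fold letter_act (l # w) \<omega> =
      act i (word_class (X i) (R i) w) (act i (word_class (X i) (R i) [l]) \<omega>)"
    using Cons.IH[OF w act_closed[OF Cons.prems(2) word_class_closed[OF l(1)]]] l(2)
    by (simp add: letter_act_def[of l])
  then show ?case
    using act_mult Cons.prems(2) l w by (simp add: word_class_closed mult_presented_group)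
qed

text \<open>
  A relator of a factor acts as the identity of that factor. In a relator \<open>u v\<^sup>-\<^sup>1\<close> expressing
  \<open>\<phi> True a = \<phi> False a\<close>, the part \<open>u\<close> acts through one factor as multiplication by \<open>a\<close>, and \<open>v\<^sup>-\<^sup>1\<close>
  acts through the other one as multiplication by \<open>a\<^sup>-\<^sup>1\<close>.
\<close>

lemma relator_act:
  assumes "r \<in> RR" "\<omega> \<in> normal_forms"
  shows "fold letter_act r \<omega> = \<omega>"
proof -
  consider (factor) i where "r \<in> R i"
    | (amalgamation) u v a where "r = u @ inv_word v" "a \<in> Y" "u \<in> \<phi> True a" "v \<in> \<phi> False a"
    using assms(1) unfolding amalgam_relators_def by blast
  then show ?thesis
  proof cases
    case factor
    then have r: "r \<in> lists (letters (X i))" using relators by blast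
    with factor have "word_class (X i) (R i) r = \<one>\<^bsub>F i\<^esub>"
      unfolding one_presented_group by (intro word_class_eqI pres_rel.relator)
    then show ?thesis using word_act_factor[OF r assms(2)] act_one[OF assms(2)] by simp
  next
    case amalgamation
    have a: "a \<in> carrier A" using amalgamation(2) Y(1) by blast
    then have "\<phi> True a \<in> carrier (F True)" "\<phi> False a \<in> carrier (F False)" by simp_all
    note u = presented_group_memberE[OF this(1) amalgamation(3)]
      and v = presented_group_memberE[OF this(2) amalgamation(4)]
    obtain L b where \<omega>: "\<omega> = (L, b)" by fastforce
    then have b: "b \<in> carrier A" "\<And>c. c \<in> carrier A \<Longrightarrow> (L, c) \<in> normal_forms"
      using assms(2) by (auto simp: normal_forms_def)
    have "fold letter_act u \<omega> = (L, b \<otimes>\<^bsub>A\<^esub> a)"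
      using word_act_factor[OF u(1) assms(2)] act_\<phi>[of L b a True] assms(2) a \<omega> u(2) by simp
    moreover have "word_class (X False) (R False) (inv_word v) = \<phi> False (inv\<^bsub>A\<^esub> a)"
      using a inv_word_class[OF v(1), of "R False"] v(2) by simp
    then have "fold letter_act (inv_word v) (L, b \<otimes>\<^bsub>A\<^esub> a) = (L, (b \<otimes>\<^bsub>A\<^esub> a) \<otimes>\<^bsub>A\<^esub> inv\<^bsub>A\<^esub> a)"
      using word_act_factor[OF inv_word_lists[OF v(1)]] act_\<phi>[of L "b \<otimes>\<^bsub>A\<^esub> a" "inv\<^bsub>A\<^esub> a" False] a b
      by (simp del: \<phi>.hom_inv)
    ultimately show ?thesis using a b amalgamation(1) \<omega> by (simp add: A.m_assoc)
  qed
qed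

lemma word_act_cong:
  "(u, v) \<in> pres_rel XX RR \<Longrightarrow> \<omega> \<in> normal_forms \<Longrightarrow> fold letter_act u \<omega> = fold letter_act v \<omega>"
proof (induction arbitrary: \<omega> rule: pres_rel.induct)
  case (cong u u' v v')
  have "u \<in> lists (letters XX)" using pres_rel_lists[OF cong(1)] by blast
  from word_act_closed[OF this cong(5)] cong(3)[OF cong(5)]
  show ?case using cong(4)[of "fold letter_act u \<omega>"] by simp
next
  case (cancel l)
  have l: "[l] \<in> lists (letters (X (side l)))" "[l, inv_letter l] \<in> lists (letters (X (side l)))"
    using side_letters[OF cancel(1)] by (auto simp: letters_def inv_letter_def)
  have "word_class (X (side l)) (R (side l)) [l, inv_letter l] = word_class (X (side l)) (R (side l)) []"
    using l(1) by (intro word_class_eqI pres_rel.cancel) simp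
  then show ?case
    using word_act_factor[OF l(2) cancel(2)] act_one[OF cancel(2)] by (simp add: one_presented_group)
next
  case (relator r)
  then show ?case by (simp add: relator_act)
qed auto

lemma ev_word_act:
  "w \<in> lists (letters XX) \<Longrightarrow> \<omega> \<in> normal_forms \<Longrightarrow>
    ev (fold letter_act w \<omega>) = ev \<omega> \<otimes>\<^bsub>G\<^esub> word_class XX RR w"
proof (induction w arbitrary: \<omega>)
  case Nil
  then show ?case using G.r_one[OF ev_closed] by (simp add: one_presented_group)
next
  case (Cons l w)
  then have l: "[l] \<in> lists (letters (X (side l)))" "[l] \<in> lists (letters XX)"
    and w: "w \<in> lists (letters XX)"
    by (auto simp: side_letters)
  have "ev (letter_act l \<omega>) = ev \<omega> \<otimes>\<^bsub>G\<^esub> word_class XX RR [l]"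
    unfolding letter_act_def ev_act[OF Cons.prems(2) word_class_closed[OF l(1)]] \<iota>_word_class[OF l(1)] ..
  then have "ev (fold letter_act (l # w) \<omega>) =
      ev \<omega> \<otimes>\<^bsub>G\<^esub> word_class XX RR [l] \<otimes>\<^bsub>G\<^esub> word_class XX RR w"
    using Cons.IH[OF w letter_act_closed] Cons.prems by simp
  also have "\<dots> = ev \<omega> \<otimes>\<^bsub>G\<^esub> word_class XX RR (l # w)"
    using G.m_assoc[OF ev_closed[OF Cons.prems(2)] word_class_closed[OF l(2)] word_class_closed[OF w]]
      mult_presented_group[OF l(2) w] by simp
  finally show ?case .
qed

text \<open>
  A word that is trivial in \<open>G\<close> acts trivially on all normal forms. Conversely, by \<open>ev_word_act\<close> the
  image of the empty normal form under a word evaluates to the class of that word, and the empty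
  normal form itself evaluates to \<open>\<one>\<close>.
\<close>

lemma word_problem:
  assumes "w \<in> lists (letters XX)"
  shows "word_class XX RR w = \<one>\<^bsub>G\<^esub> \<longleftrightarrow> fold letter_act w ([], \<one>\<^bsub>A\<^esub>) = ([], \<one>\<^bsub>A\<^esub>)"
proof
  have base: "([], \<one>\<^bsub>A\<^esub>) \<in> normal_forms" by (simp add: normal_forms_def)
  {
    assume "word_class XX RR w = \<one>\<^bsub>G\<^esub>"
    then have "(w, []) \<in> pres_rel XX RR"
      unfolding one_presented_group using word_class_eq_iff assms by blast
    from word_act_cong[OF this base]
    show "fold letter_act w ([], \<one>\<^bsub>A\<^esub>) = ([], \<one>\<^bsub>A\<^esub>)" by simp
  next
    assume "fold letter_act w ([], \<one>\<^bsub>A\<^esub>) = ([], \<one>\<^bsub>A\<^esub>)"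
    moreover have "ev ([], \<one>\<^bsub>A\<^esub>) = \<one>\<^bsub>G\<^esub>" by (simp add: ev_def)
    ultimately show "word_class XX RR w = \<one>\<^bsub>G\<^esub>"
      using ev_word_act[OF assms base] G.l_one[OF word_class_closed[OF assms]] by argo
  }
qed

section \<open>The decision procedure\<close>

text \<open>
  The stack symbols are the elements of the two factors and the control states are the elements of
  \<open>A\<close>, which is finite because it embeds into a factor. Starting from the empty normal form, the
  machine reads a word and ends where it started exactly if the word is trivial.
\<close>

lemma decidable_triviality:
  assumes "\<And>i. finite (X i)" "\<And>i. finite (carrier (F i))"
  shows "decidable_for_tuples (letters XX) (\<lambda>ws. \<forall>w\<in>set ws. word_class XX RR w = \<one>\<^bsub>G\<^esub>)"
proof (rule decidable_for_tuples_all)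
  fix e :: "'x letter \<Rightarrow> nat" assume e: "inj_on e (letters XX)"
  let ?\<Gamma> = "SIGMA i : UNIV. carrier (F i)"
  have "reduced L \<Longrightarrow> L \<in> lists ?\<Gamma>" for L by (induction L rule: reduced.induct) auto
  then have NF: "normal_forms \<subseteq> lists ?\<Gamma> \<times> carrier A" by (auto simp: normal_forms_def)
  have "finite (letters XX)" using assms(1) by (simp add: letters_def)
  moreover have "finite ?\<Gamma>" using assms(2) by (intro finite_SigmaI) simp_all
  moreover have "finite (carrier A)"
    by (rule inj_on_finite[OF inj_\<phi>[of True] _ assms(2)[of True]]) auto
  ultimately obtain t where "total_rec t" and "\<forall>w\<in>lists (letters XX).
      t (list_encode (map e w)) = (if fold letter_act w ([], \<one>\<^bsub>A\<^esub>) = ([], \<one>\<^bsub>A\<^esub>) then 1 else 0)"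
  proof (atomize_elim, rule total_rec_pushdown[OF _ _ _ e NF])
    show "letter_act l (L, a) = (case letter_act l (take 1 L, a) of (L', b) \<Rightarrow> (L' @ drop 1 L, b))"
      for l L a
      unfolding letter_act_def by (rule act_local)
    show "([], \<one>\<^bsub>A\<^esub>) \<in> normal_forms" by (simp add: normal_forms_def)
  qed (rule letter_act_closed)
  then show "\<exists>t. total_rec t \<and> (\<forall>w\<in>lists (letters XX).
      t (list_encode (map e w)) = (if word_class XX RR w = \<one>\<^bsub>G\<^esub> then 1 else 0))"
    using word_problem by (intro exI[of _ t]) simp
qed

end

theorem corollary5p9:
  fixes X1 X2 :: "'x set"
    and R1 R2 :: "'x word set"
    and A :: "('a, 'm) monoid_scheme"
    and Y :: "'a set"
    and \<phi>1 \<phi>2 :: "'a \<Rightarrow> 'x word set"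
  assumes "finite X1" and "finite X2"
    and "letters X1 \<inter> letters X2 = {}"
    and "finite R1" and "R1 \<subseteq> lists (letters X1)"
    and "finite R2" and "R2 \<subseteq> lists (letters X2)"
    and "finite (carrier (presented_group X1 R1))"
    and "finite (carrier (presented_group X2 R2))"
    and "group A"
    and "Y \<subseteq> carrier A" and "generate A Y = carrier A"
    and "\<phi>1 \<in> mon A (presented_group X1 R1)"
    and "\<phi>2 \<in> mon A (presented_group X2 R2)"
  shows "let X = X1 \<union> X2;
             R = amalgam_relators R1 R2 Y \<phi>1 \<phi>2;
             G = presented_group X R
         in decidable_for_tuples (letters X)
              (\<lambda>hs. generate G (word_class X R ` set hs) = {\<one>\<^bsub>G\<^esub>})"
proof -
  let ?X = "\<lambda>i. if i then X1 else X2" and ?R = "\<lambda>i. if i then R1 else R2"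
    and ?\<phi> = "\<lambda>i. if i then \<phi>1 else \<phi>2"
  let ?XX = "X1 \<union> X2" and ?RR = "amalgam_relators R1 R2 Y \<phi>1 \<phi>2"
  let ?G = "presented_group ?XX ?RR"
  interpret amalgam_presentation ?X ?R A Y ?\<phi>
    by (rule amalgam_presentation.intro) (use assms in simp_all)
  have "decidable_for_tuples (letters ?XX) (\<lambda>hs. \<forall>w\<in>set hs. word_class ?XX ?RR w = \<one>\<^bsub>?G\<^esub>)"
    using decidable_triviality assms by simp
  moreover have "generate ?G (word_class ?XX ?RR ` set hs) = {\<one>\<^bsub>?G\<^esub>} \<longleftrightarrow>
      (\<forall>w\<in>set hs. word_class ?XX ?RR w = \<one>\<^bsub>?G\<^esub>)" if "hs \<in> lists (lists (letters ?XX))" for hs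
  proof -
    have "word_class ?XX ?RR ` set hs \<subseteq> carrier ?G"
      using that word_class_closed by fastforce
    from group.generate_eq_one_iff[OF group_presented_group this] show ?thesis by simp
  qed
  ultimately show ?thesis
    by (simp add: Let_def decidable_for_tuples_def decides_def)
qed

end
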